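(* Let $\alpha\in(0,3)$ and $c_\delta\in(0,\infty)$, and for integers $s\ge1$ let $$M_s=\sum_{v=1}^{\lfloor s/2\rfloor}c_\delta^{2v}\,\frac{2^{s-v}}{v!}\sum_{\substack{m_1,\ldots,m_v\ge2\\ m_1+\cdots+m_v=s}}\frac{s!}{m_1!\cdots m_v!}\prod_{\ell=1}^v c_{m_\ell}(\alpha)^2 .$$ Then the moment sequence $(M_s)_{s\ge1}$ uniquely characterizes a probability law, i.e. there is exactly one probability measure on $\mathbb R$ whose $s$-th moment is $M_s$ for all $s\ge1$.
   Context: For integers $m\ge2$, $$c_m(\alpha)=\begin{cases}\dfrac{\Gamma(m-\alpha/2)}{\Gamma(1-\alpha/2)\Gamma(m)},&\alpha\in(0,2),\\[2mm]\dfrac{\Gamma(1+\alpha/2)\Gamma(m-\alpha/2)}{\Gamma(m)},&\alpha\in[2,4).\end{cases}$$ The inner sum is over ordered tuples of integers; empty sums are $0$ (so $M_1=0$). *)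

theory Defs
  imports "HOL-Probability.Probability"
begin

text \<open>The two cases are \<open>0 < \<alpha> < 2\<close> and \<open>2 \<le> \<alpha> < 4\<close>; values for other \<open>\<alpha>\<close>, or for
  \<open>m < 2\<close>, are irrelevant.\<close>

definition c_coeff :: "real \<Rightarrow> nat \<Rightarrow> real" where
  "c_coeff \<alpha> m =
     (if \<alpha> < 2 then Gamma (real m - \<alpha> / 2) / (Gamma (1 - \<alpha> / 2) * Gamma (real m))
      else Gamma (1 + \<alpha> / 2) * Gamma (real m - \<alpha> / 2) / Gamma (real m))"

text \<open>Ordered \<open>v\<close>-tuples \<open>(m\<^sub>1, \<dots>, m\<^sub>v)\<close> of integers \<open>\<ge> 2\<close> with sum \<open>s\<close>, as lists.\<close>

definition tuples :: "nat \<Rightarrow> nat \<Rightarrow> nat list set" where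
  "tuples v s = {ms. length ms = v \<and> (\<forall>m\<in>set ms. 2 \<le> m) \<and> sum_list ms = s}"

lemma finite_tuples: "finite (tuples v s)"
proof (rule finite_subset)
  show "tuples v s \<subseteq> {ms. set ms \<subseteq> {..s} \<and> length ms = v}"
    by (auto simp: tuples_def member_le_sum_list)
  show "finite {ms. set ms \<subseteq> {..s} \<and> length ms = v}"
    by (rule finite_lists_length_eq) simp
qed

definition M_seq :: "real \<Rightarrow> real \<Rightarrow> nat \<Rightarrow> real" where
  "M_seq \<alpha> c\<^sub>\<delta> s =
     (\<Sum>v = 1..s div 2. c\<^sub>\<delta> ^ (2 * v) * (2 ^ (s - v) / fact v) *
        (\<Sum>ms\<in>tuples v s.
           fact s / prod_list (map fact ms) * prod_list (map (\<lambda>m. (c_coeff \<alpha> m)\<^sup>2) ms)))"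

end

theory Submission
  imports Defs "HOL-Complex_Analysis.Laurent_Convergence"
begin

text \<open>Dividing \<open>M\<^sub>s\<close> by \<open>s!\<close> and writing \<open>2\<^sup>s\<^sup>-\<^sup>v\<close> as the product of the \<open>2 ^ (m\<^sub>l - 1)\<close> turns the defining sum into the
\<open>s\<close>-th coefficient of \<open>exp (\<Sum>m\<ge>2. \<kappa>\<^sub>m z\<^sup>m / m!)\<close> with \<open>\<kappa>\<^sub>m = c\<^sub>\<delta>\<^sup>2 * 2 ^ (m - 1) * c\<^sub>m(\<alpha>)\<^sup>2\<close>
(\<open>M_seq_eq_exp_cumulant\<close>). So the \<open>M\<^sub>s\<close> are to be the moments of a centred law with cumulants \<open>\<kappa>\<^sub>m\<close>. What
makes this possible is positivity: \<open>c\<^sub>m(\<alpha>) / c\<^sub>2(\<alpha>)\<close> is the moment of order \<open>m - 2\<close> of the beta law with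
parameters \<open>2 - \<alpha>/2\<close> and \<open>\<alpha>/2\<close>. Hence \<open>\<kappa>\<^sub>m = \<kappa>\<^sub>2 * E (X ^ (m - 2))\<close>, where \<open>X\<close> is twice the product of two
independent beta variables (\<open>cumulant_eq_moment\<close>). In other words, the \<open>\<kappa>\<^sub>m\<close> are the cumulants
of the infinitely divisible law whose Kolmogorov measure is \<open>\<kappa>\<^sub>2\<close> times the law of \<open>X\<close>, and this measure
lives on \<open>[0, 2]\<close>.

Such a law is constructed for every bounded \<open>X\<close> (\<open>ex_law_with_kolmogorov_measure\<close>) as a limit of
row sums of a triangular array. The steps of row \<open>n\<close> are copies of a variable \<open>Y\<close> with values in a bounded
interval which, given \<open>X\<close>, takes two values, has mean zero and satisfies \<open>Y\<^sup>2 = X * Y + \<kappa>\<^sub>2 / n\<close>. This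
relation yields a recursion for the mixed moments of \<open>X\<close> and \<open>Y\<close>, from which
\<open>n * E (Y ^ (m + 2))\<close> tends to \<open>\<kappa>\<^sub>2 * E (X ^ m)\<close>. So the characteristic functions of the row sums converge to
\<open>exp (\<Sum>m\<ge>2. \<kappa>\<^sub>m (i t)\<^sup>m / m!)\<close>. The row sums have uniformly bounded exponential moments, hence they are
tight, and a weak limit has this characteristic function and an exponential moment. Comparing power
series in \<open>t\<close> identifies its moments with the \<open>M\<^sub>s\<close>.

For uniqueness, \<open>\<bar>X\<bar> \<le> 2\<close> gives \<open>\<kappa>\<^sub>m \<le> \<kappa>\<^sub>2 * 2 ^ (m - 2)\<close>, so the exponential generating function of the
\<open>M\<^sub>s\<close> is entire. Then the moments determine the characteristic function
(\<open>char_eq_moment_series\<close>), and this determines the law.\<close>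

section \<open>Characteristic functions as moment series\<close>

text \<open>Convergence of the moment series, at a single \<open>t\<close> and to any value, already forces this value to be
the characteristic function, since the Taylor remainder is controlled by a term of the series.\<close>

lemma (in real_distribution) char_eq_moment_series:
  assumes moments: "\<And>k. integrable M (\<lambda>x. x ^ k)"
    and series: "(\<lambda>k. (\<i> * complex_of_real t) ^ k / fact k * complex_of_real (expectation (\<lambda>x. x ^ k))) sums z"
  shows "char M t = z"
proof -
  let ?a = "\<lambda>k. (\<i> * complex_of_real t) ^ k / fact k * complex_of_real (expectation (\<lambda>x. x ^ k))"
  let ?S = "\<lambda>n. \<Sum>k\<le>n. ?a k"
  \<comment> \<open>Only even orders are used: there the remainder in \<open>char_approx1\<close>, which involves
    absolute moments, is twice the modulus of the last term of the series itself.\<close>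
  have sub: "filterlim (\<lambda>j::nat. 2 * j) sequentially sequentially"
    by (rule filterlim_subseq) (auto simp: strict_mono_def)
  have "?a \<longlonglongrightarrow> 0"
    using series by (simp add: sums_summable summable_LIMSEQ_zero)
  then have "(\<lambda>j. ?a (2 * j)) \<longlonglongrightarrow> 0"
    using filterlim_compose sub by blast
  then have small: "(\<lambda>j. 2 * norm (?a (2 * j))) \<longlonglongrightarrow> 0"
    by (intro tendsto_mult_right_zero tendsto_norm_zero)
  have "norm (?S (2 * j) - char M t) \<le> 2 * norm (?a (2 * j))" for j
  proof -
    have "norm (?S (2 * j) - char M t) \<le> (2 * \<bar>t\<bar> ^ (2 * j) / fact (2 * j)) * expectation (\<lambda>x. \<bar>x\<bar> ^ (2 * j))"
      using char_approx1[of "2 * j" t] moments by (simp add: norm_minus_commute)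
    also have "\<dots> = 2 * norm (?a (2 * j))"
      by (simp add: norm_mult norm_divide norm_power power_even_abs)
    finally show ?thesis .
  qed
  then have "(\<lambda>j. ?S (2 * j) - char M t) \<longlonglongrightarrow> 0"
    by (intro Lim_null_comparison[OF _ small] always_eventually) auto
  then have "(\<lambda>j. ?S (2 * j)) \<longlonglongrightarrow> char M t"
    by (simp add: LIM_zero_iff)
  moreover have "(\<lambda>j. ?S (2 * j)) \<longlonglongrightarrow> z"
    using series sub filterlim_compose unfolding sums_def_le by blast
  ultimately show ?thesis
    by (rule LIMSEQ_unique)
qed

lemma real_distribution_eqI_moment_series:
  assumes M: "real_distribution M" "\<And>k. integrable M (\<lambda>x. x ^ k)" "\<And>k. (\<integral>x. x ^ k \<partial>M) = m k"
    and N: "real_distribution N" "\<And>k. integrable N (\<lambda>x. x ^ k)" "\<And>k. (\<integral>x. x ^ k \<partial>N) = m k"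
    and series: "\<And>t. summable (\<lambda>k. (\<i> * complex_of_real t) ^ k / fact k * complex_of_real (m k))"
  shows "M = N"
proof (rule Levy_uniqueness)
  show "char M = char N"
  proof
    fix t
    let ?z = "\<Sum>k. (\<i> * complex_of_real t) ^ k / fact k * complex_of_real (m k)"
    have "char M t = ?z"
      using series M(2) by (intro real_distribution.char_eq_moment_series[OF M(1)]) (auto simp: M(3) summable_sums)
    moreover have "char N t = ?z"
      using series N(2) by (intro real_distribution.char_eq_moment_series[OF N(1)]) (auto simp: N(3) summable_sums)
    ultimately show "char M t = char N t" by simp
  qed
qed (fact M N)+

text \<open>A power series in a complex variable has isolated zeros, so its values on a real interval around 0 determine
its coefficients.\<close>

lemma powser_coeffs_unique_on_reals:
  fixes a b :: "nat \<Rightarrow> complex"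
  assumes "0 < r"
    and a: "\<And>t::real. \<bar>t\<bar> < r \<Longrightarrow> (\<lambda>n. a n * complex_of_real t ^ n) sums f t"
    and b: "\<And>t::real. \<bar>t\<bar> < r \<Longrightarrow> (\<lambda>n. b n * complex_of_real t ^ n) sums f t"
  shows "a = b"
proof -
  define c where "c n = a n - b n" for n
  have c: "(\<lambda>n. c n * complex_of_real t ^ n) sums 0" if "\<bar>t\<bar> < r" for t :: real
    using sums_diff[OF a[OF that] b[OF that]] by (simp add: c_def algebra_simps)
  have inside: "(\<lambda>n. c n * z ^ n) sums (\<Sum>n. c n * z ^ n)" if "norm z < r" for z
  proof -
    obtain t where "norm z < t" "t < r" using dense \<open>norm z < r\<close> by blast
    moreover from this have "0 \<le> t" using norm_ge_zero[of z] by linarith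
    ultimately have "\<bar>t\<bar> < r" "norm z < norm (complex_of_real t)" by simp_all
    then show ?thesis
      using c by (intro summable_sums powser_inside[of c "complex_of_real t" z]) (auto simp: sums_iff)
  qed
  have c0: "c 0 = 0"
    using c[of 0] \<open>0 < r\<close> by simp
  have "c m = 0" for m
  proof (rule ccontr)
    assume "c m \<noteq> 0"
    then have "m > 0" using c0 by (cases m) auto
    have "(\<lambda>n. c n * (z - 0) ^ n) sums (\<Sum>n. c n * z ^ n)" if "norm (z - 0) < r" for z
      using inside that by simp
    moreover have "(\<Sum>n. c n * 0 ^ n) = 0"
      using c0 by simp
    ultimately obtain s where s: "0 < s" "\<And>z. z \<in> cball 0 s - {0} \<Longrightarrow> (\<Sum>n. c n * z ^ n) \<noteq> 0"
      using powser_0_nonzero[OF \<open>0 < r\<close>, where a = c and \<xi> = 0 and m = m and f = "\<lambda>z. \<Sum>n. c n * z ^ n"] \<open>c m \<noteq> 0\<close> \<open>m > 0\<close> by metis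
    define t where "t = min s (r / 2)"
    have "0 < t" "t \<le> s" "t < r" using s(1) \<open>0 < r\<close> by (auto simp: t_def)
    then have "(\<Sum>n. c n * complex_of_real t ^ n) = 0"
      using c[of t] by (simp add: sums_iff)
    moreover have "complex_of_real t \<in> cball 0 s - {0}"
      using \<open>0 < t\<close> \<open>t \<le> s\<close> by simp
    ultimately show False using s(2) by blast
  qed
  then show ?thesis by (auto simp: c_def)
qed

lemma abs_power_le_fact_exp: "\<bar>x ^ k\<bar> \<le> fact k * exp \<bar>x :: real\<bar>"
proof -
  obtain \<theta> where "exp \<bar>x\<bar> = (\<Sum>m<Suc k. \<bar>x\<bar> ^ m / fact m) + exp \<theta> / fact (Suc k) * \<bar>x\<bar> ^ Suc k"
    using Maclaurin_exp_le[of "\<bar>x\<bar>" "Suc k"] by blast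
  moreover have "(\<Sum>m<Suc k. \<bar>x\<bar> ^ m / fact m) \<ge> \<bar>x\<bar> ^ k / fact k"
    by (simp add: sum_nonneg)
  moreover have "exp \<theta> / fact (Suc k) * \<bar>x\<bar> ^ Suc k \<ge> 0"
    by simp
  ultimately have "\<bar>x\<bar> ^ k / fact k \<le> exp \<bar>x\<bar>" by linarith
  then show ?thesis unfolding power_abs by (simp add: pos_divide_le_eq mult.commute)
qed

lemma (in real_distribution) exp_moment_imp_moments:
  assumes int: "integrable M (\<lambda>x. exp \<bar>x\<bar>)"
  shows "integrable M (\<lambda>x. x ^ k)"
    and "\<bar>expectation (\<lambda>x. x ^ k)\<bar> \<le> fact k * expectation (\<lambda>x. exp \<bar>x\<bar>)"
proof -
  have bound: "integrable M (\<lambda>x. fact k * exp \<bar>x\<bar>)" using int by simp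
  show pow: "integrable M (\<lambda>x. x ^ k)"
    by (rule Bochner_Integration.integrable_bound[OF bound])
       (simp_all add: abs_mult abs_power_le_fact_exp)
  have "\<bar>expectation (\<lambda>x. x ^ k)\<bar> \<le> expectation (\<lambda>x. \<bar>x ^ k\<bar>)"
    by (rule integral_abs_bound)
  also have "\<dots> \<le> expectation (\<lambda>x. fact k * exp \<bar>x\<bar>)"
    by (intro integral_mono bound integrable_abs pow abs_power_le_fact_exp)
  finally show "\<bar>expectation (\<lambda>x. x ^ k)\<bar> \<le> fact k * expectation (\<lambda>x. exp \<bar>x\<bar>)" by simp
qed

text \<open>An exponential moment makes the moment series converge near 0. There it must agree with any other
expansion of the characteristic function, so the moments can be read off from that expansion.\<close>

lemma (in real_distribution) moments_of_analytic_char: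
  assumes int: "integrable M (\<lambda>x. exp \<bar>x\<bar>)"
    and char: "\<And>t. (\<lambda>n. a n * (\<i> * complex_of_real t) ^ n) sums char M t"
  shows "complex_of_real (expectation (\<lambda>x. x ^ n)) = fact n * a n"
proof -
  let ?m = "\<lambda>n. complex_of_real (expectation (\<lambda>x. x ^ n))"
  \<comment> \<open>Both sides are the coefficients of the characteristic function as a power series in the real
    variable \<open>t\<close>; the moment series is only known to converge for \<open>\<bar>t\<bar> < 1\<close>.\<close>
  have "(\<lambda>n. a n * \<i> ^ n) = (\<lambda>n. ?m n / fact n * \<i> ^ n)"
  proof (rule powser_coeffs_unique_on_reals[of 1 _ "char M"])
    fix t :: real assume t: "\<bar>t\<bar> < 1"
    show "(\<lambda>n. a n * \<i> ^ n * complex_of_real t ^ n) sums char M t"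
      using char[of t] by (simp add: power_mult_distrib mult.assoc)
    let ?b = "\<lambda>n. (\<i> * complex_of_real t) ^ n / fact n * ?m n"
    have "summable ?b"
    proof (rule summable_comparison_test')
      show "summable (\<lambda>n. expectation (\<lambda>x. exp \<bar>x\<bar>) * \<bar>t\<bar> ^ n)"
        using t by (intro summable_mult summable_geometric) auto
      fix n :: nat
      have "norm (?b n) = \<bar>t\<bar> ^ n * (\<bar>expectation (\<lambda>x. x ^ n)\<bar> / fact n)"
        by (simp add: norm_mult norm_divide norm_power)
      also have "\<dots> \<le> \<bar>t\<bar> ^ n * expectation (\<lambda>x. exp \<bar>x\<bar>)"
        using exp_moment_imp_moments(2)[OF int, of n] by (intro mult_left_mono) (auto simp: field_simps)
      finally show "norm (?b n) \<le> expectation (\<lambda>x. exp \<bar>x\<bar>) * \<bar>t\<bar> ^ n" by (simp add: mult.commute)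
    qed
    then have "?b sums suminf ?b" by (rule summable_sums)
    moreover from this have "char M t = suminf ?b"
      by (rule char_eq_moment_series[OF exp_moment_imp_moments(1)[OF int]])
    ultimately show "(\<lambda>n. ?m n / fact n * \<i> ^ n * complex_of_real t ^ n) sums char M t"
      by (simp add: power_mult_distrib mult_ac)
  qed simp
  then have "a n * \<i> ^ n = ?m n / fact n * \<i> ^ n" by meson
  then show ?thesis by (simp add: field_simps)
qed

section \<open>Weak limits under an exponential moment bound\<close>

lemma exp_moment_bound_imp_tight:
  assumes dist: "\<And>n. real_distribution (\<sigma> n)"
    and int: "\<And>n. integrable (\<sigma> n) (\<lambda>x. exp \<bar>x\<bar>)"
    and bound: "\<And>n. (\<integral>x. exp \<bar>x\<bar> \<partial>\<sigma> n) \<le> B"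
  shows "tight \<sigma>"
  unfolding tight_def
proof (intro conjI allI impI dist)
  fix \<epsilon> :: real assume "\<epsilon> > 0"
  define a where "a = \<bar>B\<bar> / \<epsilon> + 1"
  have a: "a > 0" "\<bar>B\<bar> < a * \<epsilon>" using \<open>\<epsilon> > 0\<close> by (auto simp: a_def field_simps intro: add_nonneg_pos)
  have "1 - \<epsilon> < measure (\<sigma> n) {-a<..a}" for n
  proof -
    interpret real_distribution "\<sigma> n" by (rule dist)
    \<comment> \<open>Markov's inequality for \<open>exp \<bar>x\<bar>\<close>, followed by \<open>a < exp a\<close>.\<close>
    have "prob (- {-a<..a}) \<le> prob {x \<in> space (\<sigma> n). exp a \<le> exp \<bar>x\<bar>}"
      by (rule finite_measure_mono) auto
    also have "\<dots> \<le> (\<integral>x. exp \<bar>x\<bar> \<partial>\<sigma> n) / exp a"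
      by (rule integral_Markov_inequality_measure[OF int, of "{}"]) auto
    also have "\<dots> \<le> \<bar>B\<bar> / a"
      using bound[of n] a exp_ge_add_one_self[of a] by (intro frac_le) linarith+
    also have "\<dots> < \<epsilon>" using a by (simp add: field_simps)
    finally show ?thesis
      using prob_compl[of "{-a<..a}"] by (simp add: Compl_eq_Diff_UNIV)
  qed
  then show "\<exists>a b. a < b \<and> (\<forall>n. 1 - \<epsilon> < measure (\<sigma> n) {a<..b})"
    using a by (intro exI[of _ "-a"] exI[of _ a]) auto
qed

lemma exp_moment_bound_weak_limit:
  assumes \<sigma>: "\<And>n. real_distribution (\<sigma> n)" and \<mu>: "real_distribution \<mu>"
    and conv: "weak_conv_m \<sigma> \<mu>"
    and int: "\<And>n. integrable (\<sigma> n) (\<lambda>x. exp \<bar>x\<bar>)"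
    and bound: "\<And>n. (\<integral>x. exp \<bar>x\<bar> \<partial>\<sigma> n) \<le> B"
  shows "integrable \<mu> (\<lambda>x. exp \<bar>x\<bar>)"
proof -
  interpret \<mu>: real_distribution \<mu> by (rule \<mu>)
  \<comment> \<open>Weak convergence only controls bounded functions, so \<open>exp \<bar>x\<bar>\<close> is truncated.\<close>
  define f :: "nat \<Rightarrow> real \<Rightarrow> real" where "f k x = min (exp \<bar>x\<bar>) (real k)" for k x
  have f_bound: "norm (f k x) \<le> real k" for k x by (simp add: f_def)
  have f_cont: "isCont (f k) x" for k x
    unfolding f_def by (intro continuous_intros)
  have [measurable]: "f k \<in> borel_measurable borel" for k
    unfolding f_def by measurable
  have f_int: "integrable \<mu> (f k)" for k
    using f_bound by (intro \<mu>.integrable_const_bound[where B = "real k"]) auto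
  have "(\<integral>x. f k x \<partial>\<mu>) \<le> B" for k
  proof (rule LIMSEQ_le_const2)
    show "(\<lambda>n. \<integral>x. f k x \<partial>\<sigma> n) \<longlonglongrightarrow> (\<integral>x. f k x \<partial>\<mu>)"
      by (rule weak_conv_imp_integral_bdd_continuous_conv[OF \<sigma> \<mu> conv f_cont f_bound])
    have "(\<integral>x. f k x \<partial>\<sigma> n) \<le> B" for n
    proof -
      interpret real_distribution "\<sigma> n" by (rule \<sigma>)
      have "(\<integral>x. f k x \<partial>\<sigma> n) \<le> (\<integral>x. exp \<bar>x\<bar> \<partial>\<sigma> n)"
        using f_bound by (intro integral_mono integrable_const_bound[where B = "real k"] int) (auto simp: f_def)
      then show ?thesis using bound[of n] by linarith
    qed
    then show "\<exists>N. \<forall>n\<ge>N. (\<integral>x. f k x \<partial>\<sigma> n) \<le> B" by blast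
  qed
  moreover have f_mono: "mono (\<lambda>k. f k x)" for x
    unfolding f_def by (intro monoI min.mono) auto
  then have "incseq (\<lambda>k. \<integral>x. f k x \<partial>\<mu>)"
    using f_int by (intro monoI integral_mono) (auto intro: monoD[OF f_mono])
  ultimately obtain l where l: "(\<lambda>k. \<integral>x. f k x \<partial>\<mu>) \<longlonglongrightarrow> l"
    using incseq_convergent by metis
  have f_lim: "(\<lambda>k. f k x) \<longlonglongrightarrow> exp \<bar>x\<bar>" for x
  proof (rule tendsto_eventually)
    obtain N where N: "exp \<bar>x\<bar> \<le> real N" using real_arch_simple by blast
    show "\<forall>\<^sub>F k in sequentially. f k x = exp \<bar>x\<bar>"
      using eventually_ge_at_top[of N] by eventually_elim (use N in \<open>auto simp: f_def\<close>)
  qed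
  have f_nonneg: "0 \<le> f k x" for k x by (simp add: f_def)
  show ?thesis
    by (rule integral_monotone_convergence_nonneg(1)[OF f_int _ _ _ l])
       (use f_mono f_nonneg f_lim in simp_all)
qed

text \<open>The form of Levy's continuity theorem that does not presuppose that the limit is a characteristic
function: tightness supplies a weakly convergent subsequence, and the characteristic function of its limit
must be \<open>\<phi>\<close>.\<close>

lemma char_limit_is_char:
  assumes \<sigma>: "\<And>n. real_distribution (\<sigma> n)"
    and int: "\<And>n. integrable (\<sigma> n) (\<lambda>x. exp \<bar>x\<bar>)"
    and bound: "\<And>n. (\<integral>x. exp \<bar>x\<bar> \<partial>\<sigma> n) \<le> B"
    and lim: "\<And>t. (\<lambda>n. char (\<sigma> n) t) \<longlonglongrightarrow> \<phi> t"
  obtains \<mu> where "real_distribution \<mu>" "integrable \<mu> (\<lambda>x. exp \<bar>x\<bar>)" "char \<mu> = \<phi>"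
proof -
  have "tight \<sigma>" using exp_moment_bound_imp_tight[OF \<sigma> int bound] .
  then obtain r \<mu> where r: "strict_mono (r :: nat \<Rightarrow> nat)" and \<mu>: "real_distribution \<mu>"
    and conv: "weak_conv_m (\<sigma> \<circ> r) \<mu>"
    using tight_imp_convergent_subsubsequence[of \<sigma> id] by (auto simp: strict_mono_def)
  have "char \<mu> t = \<phi> t" for t
  proof (rule LIMSEQ_unique)
    show "(\<lambda>n. char ((\<sigma> \<circ> r) n) t) \<longlonglongrightarrow> char \<mu> t"
      using \<sigma> by (intro levy_continuity1[OF _ \<mu> conv]) auto
    show "(\<lambda>n. char ((\<sigma> \<circ> r) n) t) \<longlonglongrightarrow> \<phi> t"
      using LIMSEQ_subseq_LIMSEQ[OF lim r] by (simp add: o_def)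
  qed
  moreover have "integrable \<mu> (\<lambda>x. exp \<bar>x\<bar>)"
    by (rule exp_moment_bound_weak_limit[OF _ \<mu> conv]) (use \<sigma> int bound in auto)
  ultimately show thesis using \<mu> that by blast
qed

section \<open>Sums of independent copies\<close>

lemma iid_sum_law:
  fixes \<nu> :: "real measure"
  assumes "real_distribution \<nu>"
  obtains \<sigma> where "real_distribution \<sigma>" "\<And>t. char \<sigma> t = char \<nu> t ^ n"
    "\<And>u. integrable \<nu> (\<lambda>x. exp (u * x)) \<Longrightarrow> integrable \<sigma> (\<lambda>x. exp (u * x))"
    "\<And>u. integrable \<nu> (\<lambda>x. exp (u * x)) \<Longrightarrow> (\<integral>x. exp (u * x) \<partial>\<sigma>) = (\<integral>x. exp (u * x) \<partial>\<nu>) ^ n"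
proof -
  interpret \<nu>: real_distribution \<nu> by fact
  interpret pr: product_prob_space "\<lambda>_::nat. \<nu>" "{..<n}" ..
  define S where "S \<omega> = (\<Sum>i<n. \<omega> i)" for \<omega> :: "nat \<Rightarrow> real"
  have [measurable]: "S \<in> borel_measurable (Pi\<^sub>M {..<n} (\<lambda>_. \<nu>))"
  proof -
    have "(\<lambda>\<omega>. \<omega> i) \<in> borel_measurable (Pi\<^sub>M {..<n} (\<lambda>_. \<nu>))" if "i < n" for i
      using measurable_component_singleton[of i "{..<n}" "\<lambda>_. \<nu>"] that
        measurable_cong_sets[OF refl \<nu>.events_eq_borel, of "Pi\<^sub>M {..<n} (\<lambda>_. \<nu>)"] by simp
    then show ?thesis unfolding S_def by (intro borel_measurable_sum) auto
  qed
  let ?\<sigma> = "distr (Pi\<^sub>M {..<n} (\<lambda>_. \<nu>)) borel S"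
  show thesis
  proof (rule that[of ?\<sigma>])
    show "real_distribution ?\<sigma>" by (rule pr.P.real_distribution_distr) simp
    show "char ?\<sigma> t = char \<nu> t ^ n" for t
    proof -
      have "char ?\<sigma> t = (\<integral>\<omega>. iexp (t * S \<omega>) \<partial>Pi\<^sub>M {..<n} (\<lambda>_. \<nu>))"
        unfolding char_def by (rule integral_distr) auto
      also have "\<dots> = (\<integral>\<omega>. (\<Prod>i<n. iexp (t * \<omega> i)) \<partial>Pi\<^sub>M {..<n} (\<lambda>_. \<nu>))"
        by (simp add: S_def sum_distrib_left exp_sum)
      also have "\<dots> = (\<Prod>i<n. \<integral>x. iexp (t * x) \<partial>\<nu>)"
        by (rule pr.product_integral_prod) (auto intro: \<nu>.integrable_iexp)
      finally show ?thesis by (simp add: char_def)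
    qed
    fix u assume u: "integrable \<nu> (\<lambda>x. exp (u * x))"
    have prod: "(\<lambda>\<omega>. exp (u * S \<omega>)) = (\<lambda>\<omega>. \<Prod>i<n. exp (u * \<omega> i))"
      by (simp add: S_def sum_distrib_left exp_sum)
    have "integrable (Pi\<^sub>M {..<n} (\<lambda>_. \<nu>)) (\<lambda>\<omega>. exp (u * S \<omega>))"
      unfolding prod by (rule pr.product_integrable_prod) (auto intro: u)
    then show "integrable ?\<sigma> (\<lambda>x. exp (u * x))"
      by (subst integrable_distr_eq) auto
    have "(\<integral>x. exp (u * x) \<partial>?\<sigma>) = (\<integral>\<omega>. exp (u * S \<omega>) \<partial>Pi\<^sub>M {..<n} (\<lambda>_. \<nu>))"
      by (rule integral_distr) auto
    also have "\<dots> = (\<Prod>i<n. \<integral>x. exp (u * x) \<partial>\<nu>)"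
      unfolding prod by (rule pr.product_integral_prod) (auto intro: u)
    finally show "(\<integral>x. exp (u * x) \<partial>?\<sigma>) = (\<integral>x. exp (u * x) \<partial>\<nu>) ^ n" by simp
  qed
qed

lemma power_tendsto_exp:
  fixes z :: "nat \<Rightarrow> complex"
  assumes bound: "\<And>n. norm (z n) \<le> 1"
    and lim: "(\<lambda>n. of_nat (Suc n) * (z n - 1)) \<longlonglongrightarrow> \<psi>"
  shows "(\<lambda>n. z n ^ Suc n) \<longlonglongrightarrow> exp \<psi>"
proof -
  \<comment> \<open>The exact \<open>Suc n\<close>-th root of \<open>exp \<psi>\<close>. It lies in the unit disc because \<open>Re \<psi> \<le> 0\<close>, so the
    powers of \<open>z n\<close> and \<open>?w n\<close> differ by at most \<open>Suc n\<close> times \<open>z n - ?w n\<close>.\<close>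
  let ?w = "\<lambda>n. exp (\<psi> / of_nat (Suc n))"
  have "(\<lambda>n. Re (of_nat (Suc n) * (z n - 1))) \<longlonglongrightarrow> Re \<psi>"
    using lim by (rule tendsto_Re)
  moreover have "Re (of_nat (Suc n) * (z n - 1)) \<le> 0" for n
  proof -
    have "Re (z n) \<le> 1" using bound[of n] complex_Re_le_cmod[of "z n"] by linarith
    moreover have "Re (of_nat (Suc n) * (z n - 1)) = real (Suc n) * (Re (z n) - 1)" by simp
    ultimately show ?thesis by (simp add: mult_nonneg_nonpos del: of_nat_Suc)
  qed
  ultimately have "Re \<psi> \<le> 0"
    by (meson LIMSEQ_le_const2)
  then have w: "norm (?w n) \<le> 1" for n
    by (simp add: Re_divide_of_nat divide_nonpos_nonneg del: of_nat_Suc)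
  have w_pow: "?w n ^ Suc n = exp \<psi>" for n
    by (simp add: exp_of_nat_mult[symmetric] del: of_nat_Suc power_Suc)
  have "(\<lambda>n. of_nat (Suc n) * (?w n - 1)) \<longlonglongrightarrow> \<psi>"
  proof (cases "\<psi> = 0")
    case False
    have "((\<lambda>h. (exp h - 1) / h) \<longlongrightarrow> (1::complex)) (at 0)"
      using DERIV_exp[of "0::complex"] by (simp add: DERIV_def)
    moreover have "filterlim (\<lambda>n. \<psi> / of_nat (Suc n)) (at 0) sequentially"
    proof -
      have "(\<lambda>n. \<psi> * of_real (inverse (real (Suc n)))) \<longlonglongrightarrow> \<psi> * of_real 0"
        by (intro tendsto_intros LIMSEQ_inverse_real_of_nat)
      then have "(\<lambda>n. \<psi> / of_nat (Suc n)) \<longlonglongrightarrow> 0"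
        by (simp add: divide_inverse del: of_nat_Suc)
      then show ?thesis using False by (auto simp: filterlim_at simp del: of_nat_Suc)
    qed
    ultimately have "(\<lambda>n. (?w n - 1) / (\<psi> / of_nat (Suc n))) \<longlonglongrightarrow> 1"
      by (rule filterlim_compose)
    then have "(\<lambda>n. \<psi> * ((?w n - 1) / (\<psi> / of_nat (Suc n)))) \<longlonglongrightarrow> \<psi> * 1"
      by (intro tendsto_intros)
    then show ?thesis using False by (simp add: mult.commute del: of_nat_Suc)
  qed simp
  then have "(\<lambda>n. of_nat (Suc n) * (z n - 1) - of_nat (Suc n) * (?w n - 1)) \<longlonglongrightarrow> \<psi> - \<psi>"
    using lim by (intro tendsto_diff)
  then have small: "(\<lambda>n. norm (of_nat (Suc n) * (z n - ?w n))) \<longlonglongrightarrow> 0"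
    by (simp add: algebra_simps tendsto_norm_zero_iff del: of_nat_Suc)
  have "norm (z n ^ Suc n - exp \<psi>) \<le> norm (of_nat (Suc n) * (z n - ?w n))" for n
    using norm_power_diff[OF bound[of n] w[of n], of "Suc n"]
    by (simp only: w_pow norm_mult norm_of_nat)
  then have "(\<lambda>n. z n ^ Suc n - exp \<psi>) \<longlonglongrightarrow> 0"
    by (intro Lim_null_comparison[OF _ small] always_eventually) auto
  then show ?thesis by (simp add: LIM_zero_iff)
qed

section \<open>Laws with a prescribed Kolmogorov measure\<close>

text \<open>The building block of the triangular array: \<open>\<nu>\<close> is the law of a variable \<open>Y\<close> with \<open>E (Y | X) = 0\<close> and
\<open>Y\<^sup>2 = X * Y + s\<close>, and \<open>e j m\<close> stands for \<open>E (X ^ j * Y ^ m)\<close>. The last equation of the conclusion is the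
quadratic relation multiplied by \<open>X ^ j * Y ^ m\<close>. When \<open>X\<close> is constant, \<open>Y\<close> is a scaled and centred Bernoulli
variable (symmetric if \<open>X = 0\<close>), so that the array interpolates between the Poisson and the Gaussian limit theorem.\<close>

lemma two_point_mixture:
  fixes X :: "'a \<Rightarrow> real"
  assumes P: "prob_space P" and X [measurable]: "X \<in> borel_measurable P"
    and bound: "\<And>\<omega>. \<omega> \<in> space P \<Longrightarrow> \<bar>X \<omega>\<bar> \<le> K" and "s > 0"
  shows "\<exists>\<nu> (e :: nat \<Rightarrow> nat \<Rightarrow> real). real_distribution \<nu> \<and> (AE y in \<nu>. \<bar>y\<bar> \<le> K + sqrt s) \<and>
    (\<forall>m. e 0 m = (\<integral>y. y ^ m \<partial>\<nu>)) \<and> (\<forall>j. e j 0 = (\<integral>\<omega>. X \<omega> ^ j \<partial>P)) \<and> (\<forall>j. e j 1 = 0) \<and>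
    (\<forall>j m. e j (m + 2) = e (j + 1) (m + 1) + s * e j m)"
proof -
  define U where "U = uniform_measure lborel {0..1::real}"
  interpret P: prob_space P by (rule P)
  interpret U: prob_space U
    unfolding U_def by (rule prob_space_uniform_measure) auto
  interpret N: pair_prob_space P U ..
  have [measurable_cong]: "sets U = sets borel" by (simp add: U_def)
  \<comment> \<open>Given \<open>X = x\<close>, the two values of \<open>Y\<close> are the roots \<open>(x \<plusminus> r) / 2\<close> of \<open>y\<^sup>2 = x * y + s\<close>. The larger root
    is chosen with probability \<open>p\<close>, the only weight for which the conditional mean vanishes; the
    uniform coordinate carries out this choice.\<close>
  define r where "r \<omega> = sqrt ((X \<omega>)\<^sup>2 + 4 * s)" for \<omega>
  define p where "p \<omega> = (r \<omega> - X \<omega>) / (2 * r \<omega>)" for \<omega>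
  define Y where "Y z = (X (fst z) - r (fst z)) / 2 + r (fst z) * indicator {0..p (fst z)} (snd z)" for z :: "'a \<times> real"
  define L where "L = K + sqrt s"
  define e where "e j m = (\<integral>z. X (fst z) ^ j * Y z ^ m \<partial>(P \<Otimes>\<^sub>M U))" for j m
  have [measurable]: "r \<in> borel_measurable P" "p \<in> borel_measurable P"
    unfolding r_def p_def by measurable
  have [measurable]: "Y \<in> borel_measurable (P \<Otimes>\<^sub>M U)"
    unfolding Y_def indicator_def atLeastAtMost_iff by measurable
  have r2: "(r \<omega>)\<^sup>2 = (X \<omega>)\<^sup>2 + 4 * s" for \<omega>
    using \<open>s > 0\<close> by (simp add: r_def)
  have Xr: "\<bar>X \<omega>\<bar> < r \<omega>" for \<omega>
    unfolding r_def using \<open>s > 0\<close> by (intro real_less_rsqrt) auto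
  then have r_pos: "r \<omega> > 0" for \<omega>
    using abs_ge_zero[of "X \<omega>"] by (meson le_less_trans)
  have p: "0 \<le> p \<omega>" "p \<omega> \<le> 1" for \<omega>
    using Xr[of \<omega>] r_pos[of \<omega>] by (auto simp: p_def field_simps)
  have r_le: "r \<omega> \<le> \<bar>X \<omega>\<bar> + 2 * sqrt s" for \<omega>
  proof (rule power2_le_imp_le)
    show "(r \<omega>)\<^sup>2 \<le> (\<bar>X \<omega>\<bar> + 2 * sqrt s)\<^sup>2"
      using \<open>s > 0\<close> by (simp add: r2 power2_sum power_mult_distrib)
  qed (use \<open>s > 0\<close> in auto)
  have Y_cases: "Y z = (X (fst z) + r (fst z)) / 2 \<or> Y z = (X (fst z) - r (fst z)) / 2" for z
    by (auto simp: Y_def indicator_def field_simps)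
  have Y_bound: "\<bar>Y z\<bar> \<le> L" if "z \<in> space (P \<Otimes>\<^sub>M U)" for z
  proof -
    have "\<bar>X (fst z)\<bar> \<le> K" using that bound by (auto simp: space_pair_measure)
    moreover have "2 * \<bar>Y z\<bar> \<le> \<bar>X (fst z)\<bar> + r (fst z)"
      using Y_cases[of z] Xr[of "fst z"] by (auto simp: abs_if split: if_splits)
    ultimately show ?thesis using r_le[of "fst z"] by (simp add: L_def)
  qed
  have X_bound: "\<bar>X (fst z)\<bar> \<le> K" if "z \<in> space (P \<Otimes>\<^sub>M U)" for z
    using that bound by (auto simp: space_pair_measure)
  have Y_quadratic: "(Y z)\<^sup>2 = X (fst z) * Y z + s" for z
  proof -
    have "2 * Y z - X (fst z) = r (fst z) \<or> 2 * Y z - X (fst z) = - r (fst z)"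
      using Y_cases[of z] by auto
    then have "(2 * Y z - X (fst z))\<^sup>2 = (r (fst z))\<^sup>2" by auto
    then show ?thesis unfolding r2 by (simp add: power2_eq_square algebra_simps)
  qed
  have integrable: "integrable (P \<Otimes>\<^sub>M U) (\<lambda>z. X (fst z) ^ j * Y z ^ m)" for j m
  proof (rule N.integrable_const_bound)
    show "AE z in P \<Otimes>\<^sub>M U. norm (X (fst z) ^ j * Y z ^ m) \<le> K ^ j * L ^ m"
    proof (rule AE_I2)
      fix z assume z: "z \<in> space (P \<Otimes>\<^sub>M U)"
      then have "0 \<le> K" using X_bound[OF z] by linarith
      then show "norm (X (fst z) ^ j * Y z ^ m) \<le> K ^ j * L ^ m"
        using X_bound[OF z] Y_bound[OF z]
        by (simp add: abs_mult power_abs) (intro mult_mono power_mono; simp)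
    qed
  qed simp
  show ?thesis
  proof (intro exI[of _ "distr (P \<Otimes>\<^sub>M U) borel Y"] exI[of _ e] conjI allI)
    show "real_distribution (distr (P \<Otimes>\<^sub>M U) borel Y)"
      by (rule N.real_distribution_distr) simp
    show "AE y in distr (P \<Otimes>\<^sub>M U) borel Y. \<bar>y\<bar> \<le> K + sqrt s"
      using Y_bound by (subst AE_distr_iff) (auto simp: L_def)
    show "e 0 m = (\<integral>y. y ^ m \<partial>distr (P \<Otimes>\<^sub>M U) borel Y)" for m
      by (subst integral_distr) (auto simp: e_def)
    show "e j 0 = (\<integral>\<omega>. X \<omega> ^ j \<partial>P)" for j
      using N.integral_fst'[OF integrable[of j 0]] by (simp add: e_def U.prob_space)
    show "e j 1 = 0" for j
    proof -
      have inner: "(\<integral>u. X \<omega> ^ j * Y (\<omega>, u) ^ 1 \<partial>U) = 0" for \<omega>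
      proof -
        have mass: "measure U {0..p \<omega>} = p \<omega>"
          unfolding U_def using p[of \<omega>] by (simp add: measure_uniform_measure)
        have "(\<integral>u. X \<omega> ^ j * Y (\<omega>, u) ^ 1 \<partial>U) =
            (\<integral>u. X \<omega> ^ j * ((X \<omega> - r \<omega>) / 2) + X \<omega> ^ j * r \<omega> * indicator {0..p \<omega>} u \<partial>U)"
          by (simp add: Y_def distrib_left mult.assoc)
        also have "\<dots> = X \<omega> ^ j * ((X \<omega> - r \<omega>) / 2) + X \<omega> ^ j * r \<omega> * measure U {0..p \<omega>}"
          by (subst Bochner_Integration.integral_add) (auto simp: U.prob_space U.emeasure_eq_measure)
        also have "\<dots> = X \<omega> ^ j * ((X \<omega> - r \<omega>) / 2 + r \<omega> * p \<omega>)"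
          by (simp only: mass distrib_left mult.assoc)
        also have "(X \<omega> - r \<omega>) / 2 + r \<omega> * p \<omega> = 0"
          using r_pos[of \<omega>] by (simp add: p_def field_simps)
        finally show ?thesis by simp
      qed
      show ?thesis
        unfolding e_def N.integral_fst'[OF integrable[of j 1], symmetric] fst_conv inner by simp
    qed
    show "e j (m + 2) = e (j + 1) (m + 1) + s * e j m" for j m
    proof -
      have "X (fst z) ^ j * Y z ^ (m + 2) =
          X (fst z) ^ (j + 1) * Y z ^ (m + 1) + s * (X (fst z) ^ j * Y z ^ m)" for z
        unfolding power_add[of "Y z" m 2] Y_quadratic by (simp add: algebra_simps)
      then show ?thesis
        unfolding e_def by (simp only: Bochner_Integration.integral_add integrable integrable_mult_right integral_mult_right_zero)
    qed
  qed
qed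

text \<open>With \<open>s = v / n\<close>, each additional factor \<open>Y\<close> beyond the second amounts to a factor \<open>X\<close> in the limit: by the
relation \<open>Y\<^sup>2 = X * Y + s\<close> a step from order \<open>m + 2\<close> to order \<open>m + 3\<close> costs only a term that tends to 0.\<close>

lemma two_point_mixture_moments_scaled:
  fixes e :: "nat \<Rightarrow> nat \<Rightarrow> nat \<Rightarrow> real"
  assumes e0: "\<And>n j. e n j 0 = \<mu> j" and e1: "\<And>n j. e n j 1 = 0"
    and rec: "\<And>n j m. e n j (m + 2) = e n (j + 1) (m + 1) + v / real (Suc n) * e n j m"
  shows "(\<lambda>n. real (Suc n) * e n j (m + 2)) \<longlonglongrightarrow> v * \<mu> (j + m)"
proof -
  have scaled_rec: "real (Suc n) * e n j (m + 2) = real (Suc n) * e n (j + 1) (m + 1) + v * e n j m" for n j m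
    unfolding rec by (simp add: distrib_left del: of_nat_Suc)
  \<comment> \<open>The second conjunct at \<open>m\<close> makes the term \<open>v * e n j (m + 1)\<close> in the recursion for order \<open>m + 3\<close>
    negligible, so that only the term of order \<open>m + 2\<close> survives.\<close>
  have "(\<forall>j. (\<lambda>n. real (Suc n) * e n j (m + 2)) \<longlonglongrightarrow> v * \<mu> (j + m)) \<and>
        (\<forall>j. (\<lambda>n. e n j (m + 1)) \<longlonglongrightarrow> 0)"
  proof (induction m)
    case 0
    have "real (Suc n) * e n j (0 + 2) = v * \<mu> j" for n j
      using scaled_rec[of n j 0] e1[of n "j + 1"] by (simp add: e0)
    then show ?case using e1 by simp
  next
    case (Suc m)
    have small: "(\<lambda>n. e n j (Suc m + 1)) \<longlonglongrightarrow> 0" for j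
    proof -
      have "(\<lambda>n. inverse (real (Suc n)) * (real (Suc n) * e n j (m + 2))) \<longlonglongrightarrow> 0 * (v * \<mu> (j + m))"
        using Suc.IH by (intro tendsto_mult[OF LIMSEQ_inverse_real_of_nat]) blast
      then show ?thesis by (simp add: mult.assoc[symmetric] del: of_nat_Suc)
    qed
    have "(\<lambda>n. real (Suc n) * e n (j + 1) (m + 2) + v * e n j (m + 1)) \<longlonglongrightarrow> v * \<mu> (j + 1 + m) + v * 0" for j
      by (intro tendsto_add tendsto_mult_left Suc.IH[THEN conjunct1, rule_format] Suc.IH[THEN conjunct2, rule_format])
    then have "(\<lambda>n. real (Suc n) * e n j (Suc m + 2)) \<longlonglongrightarrow> v * \<mu> (j + Suc m)" for j
      using scaled_rec[of _ j "Suc m"] by (simp add: add.commute[of m] numeral_2_eq_2)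
    then show ?case using small by auto
  qed
  then show ?thesis by auto
qed

lemma (in real_distribution) integrable_power_bounded:
  assumes "AE x in M. \<bar>x\<bar> \<le> L"
  shows "integrable M (\<lambda>x. x ^ k)"
proof (rule integrable_const_bound[where B = "L ^ k"])
  show "AE x in M. norm (x ^ k) \<le> L ^ k"
    using assms by eventually_elim (simp add: power_abs power_mono)
qed simp

lemma (in real_distribution) abs_moment_le:
  assumes bounded: "AE x in M. \<bar>x\<bar> \<le> L"
  shows "\<bar>expectation (\<lambda>x. x ^ (m + 2))\<bar> \<le> expectation (\<lambda>x. x\<^sup>2) * L ^ m"
proof -
  have "\<bar>expectation (\<lambda>x. x ^ (m + 2))\<bar> \<le> expectation (\<lambda>x. \<bar>x ^ (m + 2)\<bar>)"
    by (rule integral_abs_bound)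
  also have "\<dots> \<le> expectation (\<lambda>x. x\<^sup>2 * L ^ m)"
  proof (rule integral_mono_AE)
    show "integrable M (\<lambda>x. \<bar>x ^ (m + 2)\<bar>)"
      by (rule integrable_abs[OF integrable_power_bounded[OF bounded]])
    show "integrable M (\<lambda>x. x\<^sup>2 * L ^ m)"
      by (rule integrable_mult_left[OF integrable_power_bounded[OF bounded]])
    show "AE x in M. \<bar>x ^ (m + 2)\<bar> \<le> x\<^sup>2 * L ^ m"
      using bounded
    proof eventually_elim
      case (elim x)
      have "\<bar>x ^ (m + 2)\<bar> = x\<^sup>2 * \<bar>x\<bar> ^ m" by (simp only: power_add abs_mult power_abs power2_abs mult.commute)
      then show ?case using elim by (simp add: mult_left_mono power_mono)
    qed
  qed
  finally show ?thesis by simp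
qed

text \<open>For a centred variable the linear term of the exponential integrates to 0, so the excess of the
exponential moment over 1 is of the order of the variance. This is what keeps the exponential moments of sums of
many such variables bounded.\<close>

lemma (in real_distribution) expectation_exp_le:
  assumes bounded: "AE x in M. \<bar>x\<bar> \<le> L" and mean: "expectation (\<lambda>x. x) = 0" and "\<bar>u\<bar> \<le> 1"
  shows "integrable M (\<lambda>x. exp (u * x))"
    and "expectation (\<lambda>x. exp (u * x)) \<le> 1 + expectation (\<lambda>x. x\<^sup>2) * exp L"
proof -
  have ux: "\<bar>u * x\<bar> \<le> \<bar>x\<bar>" for x
    using \<open>\<bar>u\<bar> \<le> 1\<close> by (simp add: abs_mult mult_left_le_one_le)
  show int: "integrable M (\<lambda>x. exp (u * x))"
  proof (rule integrable_const_bound[where B = "exp L"])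
    show "AE x in M. norm (exp (u * x)) \<le> exp L"
      using bounded
    proof eventually_elim
      case (elim x)
      then show ?case using ux[of x] by simp
    qed
  qed simp
  note pow = integrable_power_bounded[OF bounded]
  have pow1: "integrable M (\<lambda>x. x)" using pow[of 1] by simp
  have "expectation (\<lambda>x. exp (u * x)) \<le> expectation (\<lambda>x. 1 + u * x + x\<^sup>2 * exp L)"
  proof (rule integral_mono_AE[OF int])
    show "integrable M (\<lambda>x. 1 + u * x + x\<^sup>2 * exp L)"
      using pow[of 2] pow1 by simp
    show "AE x in M. exp (u * x) \<le> 1 + u * x + x\<^sup>2 * exp L"
      using bounded
    proof eventually_elim
      case (elim x)
      obtain \<theta> where \<theta>: "\<bar>\<theta>\<bar> \<le> \<bar>u * x\<bar>" "exp (u * x) = (\<Sum>m<2. (u * x) ^ m / fact m) + exp \<theta> / fact 2 * (u * x)\<^sup>2"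
        using Maclaurin_exp_le[of "u * x" 2] by blast
      have "exp \<theta> / fact 2 * (u * x)\<^sup>2 \<le> exp L * x\<^sup>2"
      proof (rule mult_mono)
        have "\<theta> \<le> L" using \<theta>(1) ux[of x] elim by linarith
        then have "exp \<theta> \<le> exp L" by simp
        then have "exp \<theta> / 2 \<le> exp L" using exp_gt_zero[of L] by linarith
        then show "exp \<theta> / fact 2 \<le> exp L" by (simp add: fact_2)
        show "(u * x)\<^sup>2 \<le> x\<^sup>2" using ux[of x] by (simp add: abs_le_square_iff)
      qed auto
      then show ?case unfolding \<theta>(2) by (simp add: numeral_2_eq_2 mult.commute)
    qed
  qed
  also have "\<dots> = 1 + expectation (\<lambda>x. x\<^sup>2) * exp L"
    using pow[of 2] pow1 mean by (simp add: prob_space[unfolded space_eq_univ])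
  finally show "expectation (\<lambda>x. exp (u * x)) \<le> 1 + expectation (\<lambda>x. x\<^sup>2) * exp L" .
qed

lemma summable_exp_tail:
  "summable (\<lambda>m. \<bar>t\<bar> ^ (m + 2) / fact (m + 2) * (v * L ^ m) :: real)"
proof (rule summable_comparison_test')
  show "summable (\<lambda>m. \<bar>t\<bar>\<^sup>2 * \<bar>v\<bar> * ((\<bar>t\<bar> * \<bar>L\<bar>) ^ m /\<^sub>R fact m))"
    by (intro summable_mult summable_exp_generic)
  fix m :: nat
  have "\<bar>t\<bar> ^ (m + 2) / fact (m + 2) \<le> \<bar>t\<bar> ^ (m + 2) / fact m"
    by (intro divide_left_mono fact_mono mult_pos_pos) auto
  then have "\<bar>t\<bar> ^ (m + 2) / fact (m + 2) * (\<bar>v\<bar> * \<bar>L\<bar> ^ m) \<le> \<bar>t\<bar> ^ (m + 2) / fact m * (\<bar>v\<bar> * \<bar>L\<bar> ^ m)"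
    by (intro mult_right_mono) auto
  also have "\<dots> = \<bar>t\<bar>\<^sup>2 * \<bar>v\<bar> * ((\<bar>t\<bar> * \<bar>L\<bar>) ^ m /\<^sub>R fact m)"
    unfolding power_add power_mult_distrib by (simp add: divide_inverse mult_ac del: power2_abs)
  finally show "norm (\<bar>t\<bar> ^ (m + 2) / fact (m + 2) * (v * L ^ m)) \<le> \<bar>t\<bar>\<^sup>2 * \<bar>v\<bar> * ((\<bar>t\<bar> * \<bar>L\<bar>) ^ m /\<^sub>R fact m)"
    by (simp only: real_norm_def abs_mult abs_divide power_abs abs_abs abs_of_nonneg[OF fact_ge_zero])
qed

lemma (in real_distribution) char_centered_bounded:
  assumes bounded: "AE x in M. \<bar>x\<bar> \<le> L" and mean: "expectation (\<lambda>x. x) = 0"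
  shows "char M t = 1 + (\<Sum>m. (\<i> * complex_of_real t) ^ (m + 2) / fact (m + 2) * complex_of_real (expectation (\<lambda>x. x ^ (m + 2))))"
proof -
  let ?a = "\<lambda>k. (\<i> * complex_of_real t) ^ k / fact k * complex_of_real (expectation (\<lambda>x. x ^ k))"
  have "summable (\<lambda>m. ?a (m + 2))"
  proof (rule summable_comparison_test'[OF summable_exp_tail])
    fix m
    show "norm (?a (m + 2)) \<le> \<bar>t\<bar> ^ (m + 2) / fact (m + 2) * (expectation (\<lambda>x. x\<^sup>2) * L ^ m)"
      unfolding norm_mult norm_divide norm_power norm_of_real norm_fact norm_ii mult_1
      by (intro mult_left_mono abs_moment_le[OF bounded]) simp
  qed
  then have sums: "?a sums ((\<Sum>m. ?a (m + 2)) + (\<Sum>k<2. ?a k))"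
    by (rule iffD1[OF sums_iff_shift[of ?a 2] summable_sums])
  have "char M t = (\<Sum>m. ?a (m + 2)) + (\<Sum>k<2. ?a k)"
    by (rule char_eq_moment_series[OF integrable_power_bounded[OF bounded] sums])
  also have "(\<Sum>k<2. ?a k) = 1"
    using mean by (simp add: numeral_2_eq_2 prob_space[unfolded space_eq_univ])
  finally show ?thesis by (simp only: add.commute)
qed

text \<open>The law with Kolmogorov measure \<open>v\<close> times the law of \<open>X\<close>: its cumulant of order \<open>m + 2\<close> is \<open>v * E (X ^ m)\<close>, and
its mean is 0. It arises as the limit of sums of \<open>n\<close> independent copies of the variable from
\<open>two_point_mixture\<close> with \<open>s = v / n\<close>.\<close>

lemma ex_law_with_kolmogorov_measure:
  fixes X :: "'a \<Rightarrow> real"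
  assumes P: "prob_space P" and X: "X \<in> borel_measurable P"
    and bound: "\<And>\<omega>. \<omega> \<in> space P \<Longrightarrow> \<bar>X \<omega>\<bar> \<le> K" and "v > 0"
  obtains \<mu> where "real_distribution \<mu>" "integrable \<mu> (\<lambda>x. exp \<bar>x\<bar>)"
    "\<And>t. char \<mu> t = exp (\<Sum>m. (\<i> * complex_of_real t) ^ (m + 2) / fact (m + 2) * complex_of_real (v * (\<integral>\<omega>. X \<omega> ^ m \<partial>P)))"
proof -
  interpret P: prob_space P by (rule P)
  \<comment> \<open>A bound for the steps of all rows at once, since their variances \<open>v / Suc n\<close> are at most \<open>v\<close>.\<close>
  define L where "L = K + sqrt v"
  have "\<exists>\<nu> (e :: nat \<Rightarrow> nat \<Rightarrow> real). real_distribution \<nu> \<and> (AE y in \<nu>. \<bar>y\<bar> \<le> K + sqrt (v / real (Suc n))) \<and>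
      (\<forall>m. e 0 m = (\<integral>y. y ^ m \<partial>\<nu>)) \<and> (\<forall>j. e j 0 = (\<integral>\<omega>. X \<omega> ^ j \<partial>P)) \<and> (\<forall>j. e j 1 = 0) \<and>
      (\<forall>j m. e j (m + 2) = e (j + 1) (m + 1) + v / real (Suc n) * e j m)" (is "\<exists>\<nu> e. ?Q n \<nu> e") for n
    using \<open>v > 0\<close> by (intro two_point_mixture[OF P X bound]) auto
  then have "\<forall>n. \<exists>p. ?Q n (fst p) (snd p)"
    by (simp only: split_paired_Ex fst_conv snd_conv) blast
  from choice[OF this] obtain p where p: "\<forall>n. ?Q n (fst (p n)) (snd (p n))" ..
  define \<nu> where "\<nu> n = fst (p n)" for n
  define e where "e n = snd (p n)" for n
  have \<nu>: "\<And>n. real_distribution (\<nu> n)" and \<nu>_bound: "\<And>n. AE y in \<nu> n. \<bar>y\<bar> \<le> K + sqrt (v / real (Suc n))"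
    and e: "\<And>n m. e n 0 m = (\<integral>y. y ^ m \<partial>\<nu> n)" "\<And>n j. e n j 0 = (\<integral>\<omega>. X \<omega> ^ j \<partial>P)" "\<And>n j. e n j 1 = 0"
      "\<And>n j m. e n j (m + 2) = e n (j + 1) (m + 1) + v / real (Suc n) * e n j m"
    unfolding \<nu>_def e_def using p by blast+
  have \<nu>_bounded: "AE y in \<nu> n. \<bar>y\<bar> \<le> L" for n
  proof -
    have "sqrt (v / real (Suc n)) \<le> sqrt v"
      using \<open>v > 0\<close> by (simp add: field_simps)
    show ?thesis
      using \<nu>_bound[of n]
    proof eventually_elim
      case (elim y)
      then show ?case using \<open>sqrt (v / real (Suc n)) \<le> sqrt v\<close> unfolding L_def by linarith
    qed
  qed
  have mean: "(\<integral>y. y \<partial>\<nu> n) = 0" for n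
    using e(1)[of n 1] e(3)[of n 0] by simp
  have var: "(\<integral>y. y\<^sup>2 \<partial>\<nu> n) = v / real (Suc n)" for n
    using e(1)[of n 2] e(4)[of n 0 0] e(3)[of n 1] e(2)[of n 0] by (simp add: P.prob_space numeral_2_eq_2)
  \<comment> \<open>The row sums of the array have exponential moments bounded uniformly in \<open>n\<close>, because
    \<open>(1 + v * exp L / Suc n) ^ Suc n \<le> exp (v * exp L)\<close>.\<close>
  have "\<exists>\<sigma>. real_distribution \<sigma> \<and> (\<forall>t. char \<sigma> t = char (\<nu> n) t ^ Suc n) \<and>
      integrable \<sigma> (\<lambda>x. exp \<bar>x\<bar>) \<and> (\<integral>x. exp \<bar>x\<bar> \<partial>\<sigma>) \<le> 2 * exp (v * exp L)" (is "\<exists>\<sigma>. ?Q n \<sigma>") for n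
  proof -
    interpret \<nu>: real_distribution "\<nu> n" by (rule \<nu>)
    obtain \<sigma> where \<sigma>: "real_distribution \<sigma>" "\<And>t. char \<sigma> t = char (\<nu> n) t ^ Suc n"
      "\<And>u. integrable (\<nu> n) (\<lambda>x. exp (u * x)) \<Longrightarrow> integrable \<sigma> (\<lambda>x. exp (u * x))"
      "\<And>u. integrable (\<nu> n) (\<lambda>x. exp (u * x)) \<Longrightarrow> (\<integral>x. exp (u * x) \<partial>\<sigma>) = (\<integral>x. exp (u * x) \<partial>\<nu> n) ^ Suc n"
      by (rule iid_sum_law[OF \<nu>[of n], of "Suc n"]) blast
    interpret \<sigma>: real_distribution \<sigma> by (rule \<sigma>)
    have int: "integrable \<sigma> (\<lambda>x. exp (u * x))" and le: "(\<integral>x. exp (u * x) \<partial>\<sigma>) \<le> exp (v * exp L)"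
      if "\<bar>u\<bar> \<le> 1" for u
    proof -
      note E = \<nu>.expectation_exp_le[OF \<nu>_bounded mean that]
      show "integrable \<sigma> (\<lambda>x. exp (u * x))" by (rule \<sigma>(3)[OF E(1)])
      have "(\<integral>x. exp (u * x) \<partial>\<sigma>) = (\<integral>x. exp (u * x) \<partial>\<nu> n) ^ Suc n" by (rule \<sigma>(4)[OF E(1)])
      also have "\<dots> \<le> (1 + v * exp L / real (Suc n)) ^ Suc n"
        using E(2) by (intro power_mono) (auto simp: var)
      also have "\<dots> \<le> exp (v * exp L)"
        using \<open>v > 0\<close> by (intro exp_ge_one_plus_x_over_n_power_n) (auto intro: order_trans[of _ 0])
      finally show "(\<integral>x. exp (u * x) \<partial>\<sigma>) \<le> exp (v * exp L)" .
    qed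
    have abs_le: "exp \<bar>x\<bar> \<le> exp (1 * x) + exp ((-1) * x)" for x :: real
      by (cases "x \<ge> 0") auto
    have sum_int: "integrable \<sigma> (\<lambda>x. exp (1 * x) + exp ((-1) * x))"
      by (intro Bochner_Integration.integrable_add int) auto
    have abs_int: "integrable \<sigma> (\<lambda>x. exp \<bar>x\<bar>)"
      by (rule Bochner_Integration.integrable_bound[OF sum_int]) (use abs_le in auto)
    have "(\<integral>x. exp \<bar>x\<bar> \<partial>\<sigma>) \<le> (\<integral>x. exp (1 * x) + exp ((-1) * x) \<partial>\<sigma>)"
      by (rule integral_mono[OF abs_int sum_int abs_le])
    also have "\<dots> = (\<integral>x. exp (1 * x) \<partial>\<sigma>) + (\<integral>x. exp ((-1) * x) \<partial>\<sigma>)"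
      by (intro Bochner_Integration.integral_add int) auto
    also have "\<dots> \<le> 2 * exp (v * exp L)"
      using le[of 1] le[of "-1"] by simp
    finally show ?thesis using \<sigma>(1,2) abs_int by blast
  qed
  then have "\<forall>n. \<exists>\<sigma>. ?Q n \<sigma>" by blast
  from choice[OF this] obtain \<sigma> where \<sigma>: "\<And>n. real_distribution (\<sigma> n)" "\<And>n t. char (\<sigma> n) t = char (\<nu> n) t ^ Suc n"
      "\<And>n. integrable (\<sigma> n) (\<lambda>x. exp \<bar>x\<bar>)" "\<And>n. (\<integral>x. exp \<bar>x\<bar> \<partial>\<sigma> n) \<le> 2 * exp (v * exp L)"
    by blast
  \<comment> \<open>The logarithm of the limiting characteristic function.\<close>
  define \<psi> where "\<psi> t = (\<Sum>m. (\<i> * complex_of_real t) ^ (m + 2) / fact (m + 2) * complex_of_real (v * (\<integral>\<omega>. X \<omega> ^ m \<partial>P)))" for t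
  have "(\<lambda>n. of_nat (Suc n) * (char (\<nu> n) t - 1)) \<longlonglongrightarrow> \<psi> t" for t
  proof -
    define a where "a m n = (\<i> * complex_of_real t) ^ (m + 2) / fact (m + 2) * complex_of_real (real (Suc n) * e n 0 (m + 2))" for m n
    have a_bound: "norm (a m n) \<le> \<bar>t\<bar> ^ (m + 2) / fact (m + 2) * (v * L ^ m)" for m n
    proof -
      interpret \<nu>: real_distribution "\<nu> n" by (rule \<nu>)
      have "\<bar>e n 0 (m + 2)\<bar> \<le> v / real (Suc n) * L ^ m"
        using \<nu>.abs_moment_le[OF \<nu>_bounded, of m] by (simp add: e(1) var del: of_nat_Suc)
      then have le: "real (Suc n) * \<bar>e n 0 (m + 2)\<bar> \<le> v * L ^ m"
        by (simp add: field_simps del: of_nat_Suc)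
      have "norm (a m n) = \<bar>t\<bar> ^ (m + 2) / fact (m + 2) * (real (Suc n) * \<bar>e n 0 (m + 2)\<bar>)"
        by (simp add: a_def norm_mult norm_divide norm_power abs_mult del: of_nat_Suc fact_Suc power_Suc add_2_eq_Suc')
      also have "\<dots> \<le> \<bar>t\<bar> ^ (m + 2) / fact (m + 2) * (v * L ^ m)"
        by (intro mult_left_mono le) simp
      finally show ?thesis .
    qed
    have "(\<lambda>n. \<Sum>m. a m n) \<longlonglongrightarrow> \<psi> t"
      unfolding \<psi>_def
    \<comment> \<open>Each moment converges after scaling, and the bound \<open>v * L ^ m\<close> dominates uniformly in \<open>n\<close>.\<close>
    proof (rule tannerys_theorem[THEN conjunct2, THEN conjunct2])
      show "(\<lambda>n. a m n) \<longlonglongrightarrow> (\<i> * complex_of_real t) ^ (m + 2) / fact (m + 2) * complex_of_real (v * (\<integral>\<omega>. X \<omega> ^ m \<partial>P))" for m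
        unfolding a_def
        using two_point_mixture_moments_scaled[of e "\<lambda>j. \<integral>\<omega>. X \<omega> ^ j \<partial>P" v 0 m, OF e(2,3,4)]
        by (intro tendsto_mult_left tendsto_of_real) simp
      show "summable (\<lambda>m. \<bar>t\<bar> ^ (m + 2) / fact (m + 2) * (v * L ^ m))" by (rule summable_exp_tail)
      show "\<forall>\<^sub>F (m, n) in sequentially \<times>\<^sub>F sequentially. norm (a m n) \<le> \<bar>t\<bar> ^ (m + 2) / fact (m + 2) * (v * L ^ m)"
        by (intro always_eventually allI) (simp only: case_prod_beta a_bound)
    qed simp
    moreover have "(\<Sum>m. a m n) = of_nat (Suc n) * (char (\<nu> n) t - 1)" for n
    proof -
      interpret \<nu>: real_distribution "\<nu> n" by (rule \<nu>)
      let ?b = "\<lambda>m. (\<i> * complex_of_real t) ^ (m + 2) / fact (m + 2) * complex_of_real (e n 0 (m + 2))"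
      have ab: "a m n = of_nat (Suc n) * ?b m" for m
        by (simp add: a_def del: of_nat_Suc)
      have "summable (\<lambda>m. a m n)"
        by (rule summable_comparison_test'[OF summable_exp_tail a_bound])
      then have "summable (\<lambda>m. inverse (of_nat (Suc n)) * a m n)"
        by (rule summable_mult)
      then have "summable ?b"
        unfolding ab by (simp add: mult.assoc[symmetric] del: of_nat_Suc)
      then have "(\<Sum>m. a m n) = of_nat (Suc n) * (\<Sum>m. ?b m)"
        unfolding ab by (rule suminf_mult)
      also have "(\<Sum>m. ?b m) = char (\<nu> n) t - 1"
        unfolding e(1) using \<nu>.char_centered_bounded[OF \<nu>_bounded mean, of t] by simp
      finally show ?thesis .
    qed
    ultimately show ?thesis by simp
  qed
  then have lim: "(\<lambda>n. char (\<sigma> n) t) \<longlonglongrightarrow> exp (\<psi> t)" for t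
    unfolding \<sigma>(2) using \<nu> by (intro power_tendsto_exp real_distribution.cmod_char_le_1)
  obtain \<mu> where "real_distribution \<mu>" "integrable \<mu> (\<lambda>x. exp \<bar>x\<bar>)" "char \<mu> = (\<lambda>t. exp (\<psi> t))"
    by (rule char_limit_is_char[OF \<sigma>(1,3,4) lim])
  then show thesis using that by (simp add: \<psi>_def)
qed

section \<open>The exponential of a power series and the moment sequence\<close>

lemma exp_fps_sums:
  fixes G :: "complex fps"
  assumes G: "fps_conv_radius G = \<infinity>" "fps_nth G 0 = 0"
  shows "(\<lambda>n. fps_nth (fps_exp 1 oo G) n * z ^ n) sums exp (eval_fps G z)"
proof -
  have "(exp \<circ> eval_fps G) has_fps_expansion (fps_exp 1 oo G)"
    using G by (intro has_fps_expansion_compose has_fps_expansion_exp1 eval_fps_has_fps_expansion) auto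
  moreover have "(exp \<circ> eval_fps G) holomorphic_on eball 0 \<infinity>"
    unfolding o_def using G(1) by (intro holomorphic_intros) auto
  ultimately show ?thesis
    using has_fps_expansion_imp_sums_complex[of "exp \<circ> eval_fps G" _ \<infinity> z] by simp
qed

lemma prod_nth_eq_prod_list: "(\<Prod>i<length xs. f (xs ! i)) = prod_list (map f xs)"
  by (induction xs) (auto simp: prod.lessThan_Suc_shift simp del: prod.lessThan_Suc)

lemma fps_power_nth_tuples:
  fixes G :: "'a::comm_ring_1 fps"
  assumes "v > 0" "fps_nth G 0 = 0" "fps_nth G 1 = 0"
  shows "fps_nth (G ^ v) s = (\<Sum>ms\<in>tuples v s. prod_list (map (fps_nth G) ms))"
proof -
  obtain w where w: "v = Suc w" using \<open>v > 0\<close> by (cases v) auto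
  have "fps_nth (G ^ v) s = (\<Sum>ms\<in>natpermute s v. \<Prod>j\<in>{0..w}. fps_nth G (ms ! j))"
    unfolding w fps_power_nth_Suc by simp
  also have "\<dots> = (\<Sum>ms\<in>natpermute s v. prod_list (map (fps_nth G) ms))"
  proof (rule sum.cong[OF refl])
    fix ms assume "ms \<in> natpermute s v"
    then have "{0..w} = {..<length ms}" by (auto simp: natpermute_def w)
    then show "(\<Prod>j\<in>{0..w}. fps_nth G (ms ! j)) = prod_list (map (fps_nth G) ms)"
      by (simp add: prod_nth_eq_prod_list)
  qed
  also have "\<dots> = (\<Sum>ms\<in>tuples v s. prod_list (map (fps_nth G) ms))"
  proof (rule sum.mono_neutral_right)
    show "finite (natpermute s v)" by (rule natpermute_finite)
    show "tuples v s \<subseteq> natpermute s v" by (auto simp: tuples_def natpermute_def)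
    show "\<forall>ms\<in>natpermute s v - tuples v s. prod_list (map (fps_nth G) ms) = 0"
    proof
      fix ms assume "ms \<in> natpermute s v - tuples v s"
      then obtain m where "m \<in> set ms" "m < 2"
        by (auto simp: tuples_def natpermute_def not_le)
      then have "fps_nth G m = 0" using assms by (cases m) (auto simp: less_2_cases_iff)
      then show "prod_list (map (fps_nth G) ms) = 0"
        using \<open>m \<in> set ms\<close> by (induction ms) auto
    qed
  qed
  finally show ?thesis .
qed

lemma tuples_eq_empty: "s < 2 * v \<Longrightarrow> tuples v s = {}"
proof -
  have "2 * length ms \<le> sum_list ms" if "\<forall>m\<in>set ms. 2 \<le> m" for ms :: "nat list"
    using that by (induction ms) auto
  then show "s < 2 * v \<Longrightarrow> tuples v s = {}" by (fastforce simp: tuples_def)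
qed

lemma fps_exp_compose_nth_tuples:
  fixes G :: "complex fps"
  assumes "s \<ge> 1" "fps_nth G 0 = 0" "fps_nth G 1 = 0"
  shows "fps_nth (fps_exp 1 oo G) s =
    (\<Sum>v = 1..s div 2. (\<Sum>ms\<in>tuples v s. prod_list (map (fps_nth G) ms)) / fact v)"
proof -
  have "fps_nth (fps_exp 1 oo G) s = (\<Sum>v = 0..s. fps_nth (G ^ v) s / fact v)"
    by (simp add: fps_compose_nth)
  also have "\<dots> = (\<Sum>v = 1..s div 2. fps_nth (G ^ v) s / fact v)"
  \<comment> \<open>The term \<open>v = 0\<close> is the constant 1 of the exponential; for \<open>2 * v > s\<close> there is no tuple.\<close>
  proof (rule sum.mono_neutral_right)
    show "\<forall>v\<in>{0..s} - {1..s div 2}. fps_nth (G ^ v) s / fact v = 0"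
    proof
      fix v assume "v \<in> {0..s} - {1..s div 2}"
      then consider "v = 0" | "v > 0" "s < 2 * v" by fastforce
      then show "fps_nth (G ^ v) s / fact v = 0"
        using assms by cases (auto simp: fps_power_nth_tuples tuples_eq_empty)
    qed
  qed auto
  also have "\<dots> = (\<Sum>v = 1..s div 2. (\<Sum>ms\<in>tuples v s. prod_list (map (fps_nth G) ms)) / fact v)"
    using assms by (intro sum.cong) (auto simp: fps_power_nth_tuples)
  finally show ?thesis .
qed

definition cumulant :: "real \<Rightarrow> real \<Rightarrow> nat \<Rightarrow> real" where
  "cumulant \<alpha> c m = c\<^sup>2 * 2 ^ (m - 1) * (c_coeff \<alpha> m)\<^sup>2"

definition cumulant_fps :: "real \<Rightarrow> real \<Rightarrow> complex fps" where
  "cumulant_fps \<alpha> c = Abs_fps (\<lambda>m. if m < 2 then 0 else complex_of_real (cumulant \<alpha> c m / fact m))"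

text \<open>The powers of \<open>c\<close> and 2 in \<open>M_seq\<close> depend on the tuple only through its length and sum, which is why they
factor over its entries.\<close>

lemma prod_list_cumulant:
  assumes "\<forall>m\<in>set ms. 2 \<le> m"
  shows "prod_list (map (fps_nth (cumulant_fps \<alpha> c)) ms) =
    complex_of_real (c ^ (2 * length ms) * 2 ^ (sum_list ms - length ms) *
      prod_list (map (\<lambda>m. (c_coeff \<alpha> m)\<^sup>2) ms) / prod_list (map fact ms))"
  using assms
proof (induction ms)
  case (Cons m ms)
  have "length ms \<le> sum_list ms"
    using Cons.prems by (induction ms) auto
  then have e: "m + sum_list ms - Suc (length ms) = (m - 1) + (sum_list ms - length ms)"
    using Cons.prems by auto
  have "prod_list (map (fps_nth (cumulant_fps \<alpha> c)) (m # ms)) =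
      complex_of_real (cumulant \<alpha> c m / fact m) * prod_list (map (fps_nth (cumulant_fps \<alpha> c)) ms)"
    using Cons.prems by (simp add: cumulant_fps_def)
  also have "\<dots> = complex_of_real (cumulant \<alpha> c m / fact m * (c ^ (2 * length ms) * 2 ^ (sum_list ms - length ms) *
      prod_list (map (\<lambda>m. (c_coeff \<alpha> m)\<^sup>2) ms) / prod_list (map fact ms)))"
    using Cons by simp
  also have "cumulant \<alpha> c m / fact m * (c ^ (2 * length ms) * 2 ^ (sum_list ms - length ms) *
      prod_list (map (\<lambda>m. (c_coeff \<alpha> m)\<^sup>2) ms) / prod_list (map fact ms)) =
      c ^ (2 * length (m # ms)) * 2 ^ (sum_list (m # ms) - length (m # ms)) *
      prod_list (map (\<lambda>m. (c_coeff \<alpha> m)\<^sup>2) (m # ms)) / prod_list (map fact (m # ms))"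
    by (simp add: e power_add cumulant_def power2_eq_square)
  finally show ?case .
qed simp

lemma M_seq_eq_exp_cumulant:
  assumes "s \<ge> 1"
  shows "complex_of_real (M_seq \<alpha> c s) = fact s * fps_nth (fps_exp 1 oo cumulant_fps \<alpha> c) s"
proof -
  let ?P = "\<lambda>ms. prod_list (map (\<lambda>m. (c_coeff \<alpha> m)\<^sup>2) ms)"
  have "fps_nth (fps_exp 1 oo cumulant_fps \<alpha> c) s =
      (\<Sum>v = 1..s div 2. (\<Sum>ms\<in>tuples v s. prod_list (map (fps_nth (cumulant_fps \<alpha> c)) ms)) / fact v)"
    using assms by (intro fps_exp_compose_nth_tuples) (auto simp: cumulant_fps_def)
  also have "\<dots> = (\<Sum>v = 1..s div 2. (\<Sum>ms\<in>tuples v s.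
      complex_of_real (c ^ (2 * v) * 2 ^ (s - v) * ?P ms / prod_list (map fact ms))) / fact v)"
    by (intro sum.cong arg_cong2[where f = "(/)"] refl) (simp add: tuples_def prod_list_cumulant)
  finally show ?thesis
    by (simp add: M_seq_def sum_distrib_left sum_divide_distrib mult_ac)
qed

section \<open>The cumulants as moments of a bounded variable\<close>

lemma set_integral_Beta:
  assumes "a > 0" "b > (0::real)"
  shows "(LINT x:{0..1}|lborel. x powr (a - 1) * (1 - x) powr (b - 1)) = Beta a b"
  using set_borel_integral_eq_integral(2)[OF integrable_Beta[OF assms]]
    integral_unique[OF has_integral_Beta_real[OF assms]] by simp

lemma Beta_real_pos: "a > 0 \<Longrightarrow> b > 0 \<Longrightarrow> Beta a b > (0::real)"
  by (simp add: Beta_def Gamma_real_pos)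

lemma ex_beta_variable:
  assumes a: "a > 0" and b: "b > (0::real)"
  obtains P :: "real measure" and X :: "real \<Rightarrow> real" where
    "prob_space P" "X \<in> borel_measurable P" "\<And>x. 0 \<le> X x \<and> X x \<le> 1"
    "\<And>k. (\<integral>x. X x ^ k \<partial>P) = Beta (a + real k) b / Beta a b"
proof -
  define f where "f x = indicator {0..1} x * (x powr (a - 1) * (1 - x) powr (b - 1)) / Beta a b" for x :: real
  \<comment> \<open>The identity, cut off so that the bounds hold everywhere and not only almost surely.\<close>
  define X where "X x = indicator {0..1} x * x" for x :: real
  have [measurable]: "f \<in> borel_measurable borel" "X \<in> borel_measurable borel"
    unfolding f_def X_def by measurable
  have f_nonneg: "f x \<ge> 0" for x
    using Beta_real_pos[OF a b] by (auto simp: f_def indicator_def)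
  have f_int: "integrable lborel f"
    using integrable_Beta[OF a b] unfolding set_integrable_def f_def by simp
  have moment: "(\<integral>x. f x * X x ^ k \<partial>lborel) = Beta (a + real k) b / Beta a b" for k
  proof -
    have "f x * X x ^ k = indicator {0..1} x *\<^sub>R (x powr (a + real k - 1) * (1 - x) powr (b - 1)) / Beta a b" for x
    proof (cases "x \<in> {0<..1}")
      case True
      then have "x powr (a + real k - 1) = x powr (a - 1) * x ^ k"
        by (simp add: powr_realpow[symmetric] powr_add[symmetric] algebra_simps)
      then show ?thesis using True by (simp add: f_def X_def)
    qed (auto simp: f_def X_def indicator_def)
    then have "(\<integral>x. f x * X x ^ k \<partial>lborel) =
        (LINT x:{0..1}|lborel. x powr (a + real k - 1) * (1 - x) powr (b - 1)) / Beta a b"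
      by (simp add: set_lebesgue_integral_def)
    then show ?thesis using a b by (simp add: set_integral_Beta)
  qed
  let ?P = "density lborel (\<lambda>x. ennreal (f x))"
  show thesis
  proof (rule that[of ?P X])
    have "(\<integral>x. f x \<partial>lborel) = 1"
      using moment[of 0] Beta_real_pos[OF a b] by simp
    then show "prob_space ?P"
      using f_int f_nonneg
      by (intro prob_spaceI) (simp add: emeasure_density nn_integral_eq_integral)
    show "0 \<le> X x \<and> X x \<le> 1" for x by (auto simp: X_def indicator_def)
    show "(\<integral>x. X x ^ k \<partial>?P) = Beta (a + real k) b / Beta a b" for k
      using f_nonneg moment[of k] by (subst integral_real_density) auto
  qed simp
qed

lemma c_coeff_2_pos: "0 < \<alpha> \<Longrightarrow> \<alpha> < 4 \<Longrightarrow> c_coeff \<alpha> 2 > 0"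
  unfolding c_coeff_def by (auto intro!: mult_pos_pos divide_pos_pos Gamma_real_pos)

lemma c_coeff_ratio:
  assumes "0 < \<alpha>" "\<alpha> < 4"
  shows "c_coeff \<alpha> (k + 2) / c_coeff \<alpha> 2 = Beta (2 - \<alpha> / 2 + real k) (\<alpha> / 2) / Beta (2 - \<alpha> / 2) (\<alpha> / 2)"
proof -
  have nonzero: "Gamma (1 + \<alpha> / 2) \<noteq> 0" "Gamma (\<alpha> / 2) \<noteq> 0"
    using Gamma_real_pos[of "1 + \<alpha> / 2"] Gamma_real_pos[of "\<alpha> / 2"] assms by linarith+
  have Gamma_2: "Gamma (2::real) = 1"
    using Gamma_fact[of 1, where 'a = real] by simp
  have args: "real (k + 2) - \<alpha> / 2 = 2 - \<alpha> / 2 + real k" "real 2 - \<alpha> / 2 = 2 - \<alpha> / 2"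
    "2 - \<alpha> / 2 + real k + \<alpha> / 2 = real (k + 2)" "2 - \<alpha> / 2 + \<alpha> / 2 = real 2"
    by auto
  \<comment> \<open>In either branch of the definition of \<open>c_coeff\<close> the factor \<open>g\<close> independent of \<open>m\<close> cancels, while
    \<open>h\<close> is the Gamma factor shared by the two beta values.\<close>
  have cancel1: "(x / (g * y)) / (z / (g * 1)) = (x * h / y) / (z * h / 1)"
    if "g \<noteq> 0" "h \<noteq> 0" for g h x y z :: real
    using that by simp
  have cancel2: "(g * x / y) / (g * z / 1) = (x * h / y) / (z * h / 1)"
    if "g \<noteq> 0" "h \<noteq> 0" for g h x y z :: real
    using that by simp
  show ?thesis
  proof (cases "\<alpha> < 2")
    case True
    then have "Gamma (1 - \<alpha> / 2) \<noteq> 0"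
      using Gamma_real_pos[of "1 - \<alpha> / 2"] by linarith
    then show ?thesis
      using True nonzero unfolding c_coeff_def Beta_def args
      by (simp only: if_True of_nat_numeral Gamma_2) (rule cancel1)
  next
    case False
    show ?thesis
      using False nonzero unfolding c_coeff_def Beta_def args
      by (simp only: if_False of_nat_numeral Gamma_2) (rule cancel2)
  qed
qed

text \<open>The product of two independent beta variables realises the squares of the moments of one of them;
the factor 2 accounts for the powers of 2 in the cumulants.\<close>

lemma ex_c_coeff_squared_variable:
  assumes "0 < \<alpha>" "\<alpha> < 4"
  obtains P :: "(real \<times> real) measure" and X :: "real \<times> real \<Rightarrow> real" where
    "prob_space P" "X \<in> borel_measurable P" "\<And>z. \<bar>X z\<bar> \<le> 2"
    "\<And>k. (\<integral>z. X z ^ k \<partial>P) = 2 ^ k * (c_coeff \<alpha> (k + 2) / c_coeff \<alpha> 2)\<^sup>2"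
proof -
  obtain P :: "real measure" and B :: "real \<Rightarrow> real" where P: "prob_space P" and [measurable]: "B \<in> borel_measurable P"
    and B: "\<And>x. 0 \<le> B x \<and> B x \<le> 1"
    and moments: "\<And>k. (\<integral>x. B x ^ k \<partial>P) = Beta (2 - \<alpha> / 2 + real k) (\<alpha> / 2) / Beta (2 - \<alpha> / 2) (\<alpha> / 2)"
    using assms by (elim ex_beta_variable[of "2 - \<alpha> / 2" "\<alpha> / 2", rotated 2]) auto
  interpret P: prob_space P by (rule P)
  interpret PP: pair_prob_space P P ..
  define X where "X z = 2 * (B (fst z) * B (snd z))" for z
  have [measurable]: "X \<in> borel_measurable (P \<Otimes>\<^sub>M P)" unfolding X_def by measurable
  have X_bound: "\<bar>X z\<bar> \<le> 2" for z
    using B[of "fst z"] B[of "snd z"] by (simp add: X_def abs_mult mult_le_one)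
  show thesis
  proof (rule that[of "P \<Otimes>\<^sub>M P" X])
    show "prob_space (P \<Otimes>\<^sub>M P)" by (rule PP.prob_space_axioms)
    fix k
    have "integrable (P \<Otimes>\<^sub>M P) (\<lambda>z. X z ^ k)"
      using X_bound by (intro PP.integrable_const_bound[where B = "2 ^ k"]) (auto simp: power_abs power_mono)
    then have "(\<integral>z. X z ^ k \<partial>(P \<Otimes>\<^sub>M P)) = (\<integral>x. \<integral>y. X (x, y) ^ k \<partial>P \<partial>P)"
      by (rule PP.integral_fst'[symmetric])
    also have "\<dots> = 2 ^ k * (\<integral>x. B x ^ k \<partial>P)\<^sup>2"
      by (simp add: X_def power_mult_distrib power2_eq_square)
    finally show "(\<integral>z. X z ^ k \<partial>(P \<Otimes>\<^sub>M P)) = 2 ^ k * (c_coeff \<alpha> (k + 2) / c_coeff \<alpha> 2)\<^sup>2"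
      using assms by (simp only: moments c_coeff_ratio)
  qed (use X_bound in auto)
qed

lemma cumulant_eq_moment:
  assumes "0 < \<alpha>" "\<alpha> < 4"
  obtains P :: "(real \<times> real) measure" and X where
    "prob_space P" "X \<in> borel_measurable P" "\<And>z. \<bar>X z\<bar> \<le> 2"
    "\<And>m. cumulant \<alpha> c (m + 2) = cumulant \<alpha> c 2 * (\<integral>z. X z ^ m \<partial>P)"
proof -
  obtain P :: "(real \<times> real) measure" and X where P: "prob_space P" "X \<in> borel_measurable P" "\<And>z. \<bar>X z\<bar> \<le> 2"
    and X: "\<And>k. (\<integral>z. X z ^ k \<partial>P) = 2 ^ k * (c_coeff \<alpha> (k + 2) / c_coeff \<alpha> 2)\<^sup>2"
    by (rule ex_c_coeff_squared_variable[OF assms]) blast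
  have "cumulant \<alpha> c (m + 2) = cumulant \<alpha> c 2 * (\<integral>z. X z ^ m \<partial>P)" for m
    using c_coeff_2_pos[OF assms] by (simp add: X cumulant_def power_divide)
  with P show thesis by (rule that)
qed

lemma abs_cumulant_le:
  assumes "0 < \<alpha>" "\<alpha> < 4"
  shows "\<bar>cumulant \<alpha> c (m + 2)\<bar> \<le> cumulant \<alpha> c 2 * 2 ^ m"
proof -
  obtain P :: "(real \<times> real) measure" and X where "prob_space P" "X \<in> borel_measurable P" and X: "\<And>z. \<bar>X z\<bar> \<le> 2"
    and cum: "\<And>m. cumulant \<alpha> c (m + 2) = cumulant \<alpha> c 2 * (\<integral>z. X z ^ m \<partial>P)"
    using cumulant_eq_moment[OF assms, of c] by blast
  then interpret prob_space P by simp
  have "\<bar>expectation (\<lambda>z. X z ^ m)\<bar> \<le> expectation (\<lambda>z. \<bar>X z ^ m\<bar>)"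
    by (rule integral_abs_bound)
  also have "\<dots> \<le> expectation (\<lambda>z. 2 ^ m)"
    by (rule integral_mono') (use X in \<open>auto simp: power_abs power_mono\<close>)
  finally have "\<bar>expectation (\<lambda>z. X z ^ m)\<bar> \<le> 2 ^ m" by (simp add: prob_space)
  moreover have "cumulant \<alpha> c 2 \<ge> 0" by (simp add: cumulant_def)
  ultimately show ?thesis
    unfolding cum by (simp add: abs_mult mult_left_mono)
qed

lemma cumulant_fps_radius:
  assumes "0 < \<alpha>" "\<alpha> < 4"
  shows "fps_conv_radius (cumulant_fps \<alpha> c) = \<infinity>"
  unfolding fps_conv_radius_def
proof (rule conv_radius_inftyI'')
  fix z :: complex
  have "summable (\<lambda>m. fps_nth (cumulant_fps \<alpha> c) (m + 2) * z ^ (m + 2))"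
  proof (rule summable_comparison_test'[OF summable_exp_tail[of "norm z" "cumulant \<alpha> c 2" 2]])
    fix m :: nat
    have "norm (fps_nth (cumulant_fps \<alpha> c) (m + 2) * z ^ (m + 2)) = norm z ^ (m + 2) / fact (m + 2) * \<bar>cumulant \<alpha> c (m + 2)\<bar>"
      by (simp add: cumulant_fps_def norm_mult norm_divide norm_power del: fact_Suc)
    also have "\<dots> \<le> norm z ^ (m + 2) / fact (m + 2) * (cumulant \<alpha> c 2 * 2 ^ m)"
      using abs_cumulant_le[OF assms] by (intro mult_left_mono) auto
    finally show "norm (fps_nth (cumulant_fps \<alpha> c) (m + 2) * z ^ (m + 2)) \<le> \<bar>norm z\<bar> ^ (m + 2) / fact (m + 2) * (cumulant \<alpha> c 2 * 2 ^ m)"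
      by simp
  qed
  then show "summable (\<lambda>m. fps_nth (cumulant_fps \<alpha> c) m * z ^ m)"
    using summable_iff_shift[of "\<lambda>m. fps_nth (cumulant_fps \<alpha> c) m * z ^ m" 2] by simp
qed

lemma eval_cumulant_fps:
  assumes "0 < \<alpha>" "\<alpha> < 4"
  shows "eval_fps (cumulant_fps \<alpha> c) z = (\<Sum>m. z ^ (m + 2) / fact (m + 2) * complex_of_real (cumulant \<alpha> c (m + 2)))"
proof -
  have "summable (\<lambda>m. fps_nth (cumulant_fps \<alpha> c) m * z ^ m)"
    using summable_fps[of z "cumulant_fps \<alpha> c"] by (simp add: cumulant_fps_radius[OF assms])
  then have "eval_fps (cumulant_fps \<alpha> c) z = (\<Sum>m. fps_nth (cumulant_fps \<alpha> c) (m + 2) * z ^ (m + 2)) +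
      (\<Sum>m<2. fps_nth (cumulant_fps \<alpha> c) m * z ^ m)"
    unfolding eval_fps_def by (rule suminf_split_initial_segment)
  also have "(\<Sum>m<2. fps_nth (cumulant_fps \<alpha> c) m * z ^ m) = 0"
    by (simp add: cumulant_fps_def)
  finally show ?thesis by (simp add: cumulant_fps_def mult.commute del: fact_Suc power_Suc)
qed

section \<open>Existence and uniqueness of the law\<close>

theorem lemma3p5:
  fixes \<alpha> c\<^sub>\<delta> :: real
  assumes "0 < \<alpha>" and "\<alpha> < 3" and "0 < c\<^sub>\<delta>"
  shows "\<exists>!\<mu> :: real measure. real_distribution \<mu> \<and>
           (\<forall>s::nat. 1 \<le> s \<longrightarrow>
              integrable \<mu> (\<lambda>x. x ^ s) \<and> integral\<^sup>L \<mu> (\<lambda>x. x ^ s) = M_seq \<alpha> c\<^sub>\<delta> s)"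
proof -
  have \<alpha>: "0 < \<alpha>" "\<alpha> < 4" using assms by auto
  define F where "F = fps_exp 1 oo cumulant_fps \<alpha> c\<^sub>\<delta>"
  have F_sums: "(\<lambda>n. fps_nth F n * z ^ n) sums exp (eval_fps (cumulant_fps \<alpha> c\<^sub>\<delta>) z)" for z
    unfolding F_def by (rule exp_fps_sums[OF cumulant_fps_radius[OF \<alpha>]]) (simp add: cumulant_fps_def)
  \<comment> \<open>Order 0, on which the hypothesis is silent, is covered by the total mass 1, which is also the
    constant coefficient of \<open>F\<close>.\<close>
  define m where "m s = (if s = 0 then 1 else M_seq \<alpha> c\<^sub>\<delta> s)" for s
  have m_F: "complex_of_real (m s) = fact s * fps_nth F s" for s
    by (auto simp: m_def F_def M_seq_eq_exp_cumulant)
  have "\<exists>\<mu>. real_distribution \<mu> \<and> (\<forall>s. integrable \<mu> (\<lambda>x. x ^ s) \<and> (\<integral>x. x ^ s \<partial>\<mu>) = m s)"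
  proof -
    obtain P :: "(real \<times> real) measure" and X where P: "prob_space P" "X \<in> borel_measurable P" "\<And>z. \<bar>X z\<bar> \<le> 2"
      and cum: "\<And>m. cumulant \<alpha> c\<^sub>\<delta> (m + 2) = cumulant \<alpha> c\<^sub>\<delta> 2 * (\<integral>z. X z ^ m \<partial>P)"
      using cumulant_eq_moment[OF \<alpha>, of c\<^sub>\<delta>] by blast
    have v_pos: "cumulant \<alpha> c\<^sub>\<delta> 2 > 0"
      using \<open>0 < c\<^sub>\<delta>\<close> c_coeff_2_pos[OF \<alpha>] by (simp add: cumulant_def)
    obtain \<mu> where \<mu>: "real_distribution \<mu>" "integrable \<mu> (\<lambda>x. exp \<bar>x\<bar>)"
      and char: "\<And>t. char \<mu> t = exp (\<Sum>m. (\<i> * complex_of_real t) ^ (m + 2) / fact (m + 2) *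
        complex_of_real (cumulant \<alpha> c\<^sub>\<delta> 2 * (\<integral>z. X z ^ m \<partial>P)))"
      by (rule ex_law_with_kolmogorov_measure[OF P v_pos]) blast
    interpret real_distribution \<mu> by (rule \<mu>)
    have "(\<lambda>n. fps_nth F n * (\<i> * complex_of_real t) ^ n) sums char \<mu> t" for t
      using F_sums[of "\<i> * complex_of_real t"] unfolding char eval_cumulant_fps[OF \<alpha>] cum .
    then have "complex_of_real (expectation (\<lambda>x. x ^ s)) = complex_of_real (m s)" for s
      unfolding m_F by (rule moments_of_analytic_char[OF \<mu>(2)])
    then show ?thesis
      using \<mu> exp_moment_imp_moments(1) by (intro exI[of _ \<mu>]) (simp only: of_real_eq_iff, blast)
  qed
  then obtain \<mu> where \<mu>: "real_distribution \<mu>" "\<And>s. integrable \<mu> (\<lambda>x. x ^ s)" "\<And>s. (\<integral>x. x ^ s \<partial>\<mu>) = m s"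
    by blast
  show ?thesis
  proof (rule ex1I[of _ \<mu>])
    show "real_distribution \<mu> \<and> (\<forall>s::nat. 1 \<le> s \<longrightarrow>
        integrable \<mu> (\<lambda>x. x ^ s) \<and> integral\<^sup>L \<mu> (\<lambda>x. x ^ s) = M_seq \<alpha> c\<^sub>\<delta> s)"
      using \<mu> by (auto simp: m_def)
  next
    fix \<mu>' :: "real measure"
    assume \<mu>': "real_distribution \<mu>' \<and> (\<forall>s::nat. 1 \<le> s \<longrightarrow>
        integrable \<mu>' (\<lambda>x. x ^ s) \<and> integral\<^sup>L \<mu>' (\<lambda>x. x ^ s) = M_seq \<alpha> c\<^sub>\<delta> s)"
    then interpret real_distribution \<mu>' by blast
    have "integrable \<mu>' (\<lambda>x. x ^ s) \<and> (\<integral>x. x ^ s \<partial>\<mu>') = m s" for s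
      using \<mu>' by (cases "s = 0") (auto simp: m_def prob_space[unfolded space_eq_univ])
    moreover have "summable (\<lambda>k. (\<i> * complex_of_real t) ^ k / fact k * complex_of_real (m k))" for t
      using F_sums[of "\<i> * complex_of_real t"] unfolding m_F by (simp add: sums_iff mult.commute)
    ultimately show "\<mu>' = \<mu>"
      using \<mu> \<mu>' by (intro real_distribution_eqI_moment_series[of \<mu>' m \<mu>]) auto
  qed
qed

end
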